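(* Let $\Theta$ be any non-empty finite parameter space, let $\mathcal I$ be the set of all (coded, finite, effective) inference bases with parameter space $\Theta$, let $L,S,C\subseteq\mathcal I\times\mathcal I$ be the likelihood, sufficiency and conditionality relations, and let $\mathcal A$ be a set. If a statistical procedure $Ev\subseteq\mathcal I\times\mathcal A$ preserves both $S$ and $C$, then $Ev(I_1)=Ev(I_2)$ for each $(I_1,I_2)\in L\setminus(S\cup C)$.
   Context: **Models and inference bases.** Fix a non-empty finite set $\Theta$ and work in a fixed set-theoretic universe. A statistical model $E$ consists of a finite non-empty sample space $\mathcal X_E$, a family of probability mass functions $f_{E,\theta}$ on $\mathcal X_E$ ($\theta\in\Theta$), and an injective outcome code $c_E:\mathcal X_E\to\mathbb N$, such that every outcome is effective: for each $x\in\mathcal X_E$ there is $\theta\in\Theta$ with $f_{E,\theta}(x)>0$. Write $\mathbb P_{E,\theta}$ for the probability with mass function $f_{E,\theta}$. An inference base is a pair $I=(E,x)$ with $x\in\mathcal X_E$; $\mathcal I$ is the set of all inference bases with parameter space $\Theta$. Below $I_i=(E_i,x_i)$. **Likelihood relation.** $(I_1,I_2)\in L$ iff there is $k>0$ with $f_{E_1,\theta}(x_1)=k f_{E_2,\theta}(x_2)$ for all $\theta\in\Theta$. **Sufficiency relation.** For a surjection $T:\mathcal X_E\to\mathcal X_{E_T}$ (a statistic), the induced model $E_T$ has mass functions $f_{E_T,\theta}(t)=\sum_{x:T(x)=t}f_{E,\theta}(x)$. $T$ is sufficient if the conditional distribution given $T$ is free of $\theta$, i.e. there is a function $g$ on $\mathcal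 X_E$ with $f_{E,\theta}(x)=g(x)f_{E_T,\theta}(T(x))$ for all $x,\theta$; it is minimal sufficient if it is sufficient and is a function of every sufficient statistic. $(I_1,I_2)\in S$ iff there are minimal sufficient statistics $T_i:\mathcal X_{E_i}\to\mathcal X_{E_{T_i}}$ (surjective), $i=1,2$, and a bijection $h:\mathcal X_{E_{T_2}}\to\mathcal X_{E_{T_1}}$ with $f_{E_{T_1},\theta}(h(t))=f_{E_{T_2},\theta}(t)$ for all $\theta\in\Theta$, $t\in\mathcal X_{E_{T_2}}$, and $T_1(x_1)=h(T_2(x_2))$. **Conditionality relation.** A statistic $A:\mathcal X_E\to\mathcal A_0$ is ancillary for $E$ if its distribution under $\mathbb P_{E,\theta}$ does not depend on $\theta$. Say $I_1\to I_2$ if there are an ancillary statistic $A:\mathcal X_{E_1}\to\mathcal A_0$ for $E_1$ with, for $a=A(x_1)$, $\mathbb P_{E_1,\theta}(A=a)>0$ for every $\theta$, and an injection $\iota:\mathcal X_{E_2}\to\mathcal X_{E_1}$ with image exactly $A^{-1}\{a\}$, $\iota(x_2)=x_1$, and $f_{E_2,\theta}(y)=f_{E_1,\theta}(\iota(y))/\mathbb P_{E_1,\theta}(A=a)$ for all $\theta\in\Theta$, $y\in\mathcal X_{E_2}$, such that at least one of the following holds: (ordinary branch) $c_{E_1}(\iota(y))=c_{E_2}(y)$ for every $y\in\mathcal X_{E_2}$; (mixed-experiment branch) $A$ is surjective onto $\mathcal A_0$ and $\mathcal A_0$ has at least two elements (no condition on codes). Then $(I_1,I_2)\in C$ iff $I_1\to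 I_2$ or $I_2\to I_1$. **Procedures.** A statistical procedure with codomain $\mathcal A$ is any relation $Ev\subseteq\mathcal I\times\mathcal A$; its output set at $I$ is $Ev(I)=\{a\in\mathcal A:(I,a)\in Ev\}$, which may be empty. $Ev$ preserves $D\subseteq\mathcal I\times\mathcal I$ if $(I_1,I_2)\in D$ implies $Ev(I_1)=Ev(I_2)$. *)

theory Defs
  imports "HOL-Probability.Probability"
begin

text \<open>
  The parameter space is the type \<open>'p\<close> (of class \<open>finite\<close> in the theorem).  Sample spaces are finite
  subsets of a type \<open>'x\<close>, which plays the role of the fixed set-theoretic universe and is assumed
  infinite in the theorem.  The statistics in the definitions below take their values in \<open>'x\<close> as
  well; since a sample space is itself a finite subset of \<open>'x\<close>, the values that any statistic takes
  on it can be relabelled injectively by elements of \<open>'x\<close>, so this is no restriction.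
\<close>

record ('p, 'x) stat_model =
  sample_space :: "'x set"
  law :: "'p \<Rightarrow> 'x pmf"
  code :: "'x \<Rightarrow> nat"

text \<open>
  A mass function on \<open>sample_space E\<close> is a \<open>pmf\<close> on \<open>'x\<close> supported there, and a code is
  \<open>undefined\<close> off the sample space.  So a model is determined by its sample space together with the
  values of its mass functions and of its code on that space.
\<close>

definition is_model :: "('p, 'x) stat_model \<Rightarrow> bool" where
  "is_model E \<longleftrightarrow>
     finite (sample_space E) \<and> sample_space E \<noteq> {} \<and>
     (\<forall>\<theta>. set_pmf (law E \<theta>) \<subseteq> sample_space E) \<and>
     code E \<in> extensional (sample_space E) \<and> inj_on (code E) (sample_space E) \<and>
     (\<forall>x\<in>sample_space E. \<exists>\<theta>. pmf (law E \<theta>) x > 0)"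

type_synonym ('p, 'x) inference_base = "('p, 'x) stat_model \<times> 'x"

definition inference_bases :: "('p, 'x) inference_base set" where
  "inference_bases = {(E, x). is_model E \<and> x \<in> sample_space E}"

definition likelihood_rel :: "('p, 'x) inference_base rel" where
  "likelihood_rel =
     {((E1, x1), (E2, x2)). (E1, x1) \<in> inference_bases \<and> (E2, x2) \<in> inference_bases \<and>
        (\<exists>k>0. \<forall>\<theta>. pmf (law E1 \<theta>) x1 = k * pmf (law E2 \<theta>) x2)}"

text \<open>
  A function \<open>T\<close> is regarded as a surjection from \<open>sample_space E\<close> onto \<open>T ` sample_space E\<close>, the
  sample space of the induced model; its values elsewhere are irrelevant.
\<close>

definition induced_law :: "('p, 'x) stat_model \<Rightarrow> ('x \<Rightarrow> 'y) \<Rightarrow> 'p \<Rightarrow> 'y pmf" where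
  "induced_law E T \<theta> = map_pmf T (law E \<theta>)"

lemma pmf_induced_law:
  assumes "is_model E"
  shows "pmf (induced_law E T \<theta>) t = (\<Sum>x | x \<in> sample_space E \<and> T x = t. pmf (law E \<theta>) x)"
proof -
  let ?B = "{x. x \<in> sample_space E \<and> T x = t}"
  have fin: "finite ?B" and supp: "set_pmf (law E \<theta>) \<subseteq> sample_space E"
    using assms by (auto simp: is_model_def)
  have "pmf (induced_law E T \<theta>) t = measure_pmf.prob (law E \<theta>) (T -` {t})"
    by (simp add: induced_law_def pmf_map)
  also have "\<dots> = measure_pmf.prob (law E \<theta>) ?B"
    using supp by (intro measure_prob_cong_0) (auto simp: set_pmf_iff)
  also have "\<dots> = (\<Sum>x\<in>?B. pmf (law E \<theta>) x)"
    using fin by (rule measure_measure_pmf_finite)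
  finally show ?thesis .
qed

definition sufficient :: "('p, 'x) stat_model \<Rightarrow> ('x \<Rightarrow> 'y) \<Rightarrow> bool" where
  "sufficient E T \<longleftrightarrow>
     (\<exists>g :: 'x \<Rightarrow> real. \<forall>x\<in>sample_space E. \<forall>\<theta>.
        pmf (law E \<theta>) x = g x * pmf (induced_law E T \<theta>) (T x))"

definition minimal_sufficient :: "('p, 'x) stat_model \<Rightarrow> ('x \<Rightarrow> 'x) \<Rightarrow> bool" where
  "minimal_sufficient E T \<longleftrightarrow> sufficient E T \<and>
     (\<forall>U :: 'x \<Rightarrow> 'x. sufficient E U \<longrightarrow> (\<exists>\<phi>. \<forall>x\<in>sample_space E. T x = \<phi> (U x)))"

definition sufficiency_rel :: "('p, 'x) inference_base rel" where
  "sufficiency_rel =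
     {((E1, x1), (E2, x2)). (E1, x1) \<in> inference_bases \<and> (E2, x2) \<in> inference_bases \<and>
        (\<exists>T1 T2 h. minimal_sufficient E1 T1 \<and> minimal_sufficient E2 T2 \<and>
           bij_betw h (T2 ` sample_space E2) (T1 ` sample_space E1) \<and>
           (\<forall>\<theta>. \<forall>t\<in>T2 ` sample_space E2.
              pmf (induced_law E1 T1 \<theta>) (h t) = pmf (induced_law E2 T2 \<theta>) t) \<and>
           T1 x1 = h (T2 x2))}"

definition ancillary :: "('p, 'x) stat_model \<Rightarrow> ('x \<Rightarrow> 'y) \<Rightarrow> bool" where
  "ancillary E A \<longleftrightarrow> (\<forall>\<theta> \<theta>'. induced_law E A \<theta> = induced_law E A \<theta>')"

text \<open>
  In \<open>conditions_to\<close>, the set \<open>A0\<close> is the codomain of the statistic \<open>A\<close>, which need not be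
  surjective in the first (ordinary) branch of the final disjunction; the second disjunct is the
  mixed-experiment branch.
\<close>

definition conditions_to :: "('p, 'x) inference_base \<Rightarrow> ('p, 'x) inference_base \<Rightarrow> bool" where
  "conditions_to = (\<lambda>(E1, x1) (E2, x2).
     \<exists>(A :: 'x \<Rightarrow> 'x) (A0 :: 'x set) (\<iota> :: 'x \<Rightarrow> 'x).
       let B = {x \<in> sample_space E1. A x = A x1} in
         A ` sample_space E1 \<subseteq> A0 \<and> ancillary E1 A \<and>
         (\<forall>\<theta>. measure_pmf.prob (law E1 \<theta>) B > 0) \<and>
         inj_on \<iota> (sample_space E2) \<and> \<iota> ` sample_space E2 = B \<and> \<iota> x2 = x1 \<and>
         (\<forall>\<theta>. \<forall>y\<in>sample_space E2.
            pmf (law E2 \<theta>) y = pmf (law E1 \<theta>) (\<iota> y) / measure_pmf.prob (law E1 \<theta>) B) \<and>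
         ((\<forall>y\<in>sample_space E2. code E1 (\<iota> y) = code E2 y) \<or>
          (A ` sample_space E1 = A0 \<and> (\<exists>a\<in>A0. \<exists>b\<in>A0. a \<noteq> b))))"

definition conditionality_rel :: "('p, 'x) inference_base rel" where
  "conditionality_rel =
     {(I1, I2). I1 \<in> inference_bases \<and> I2 \<in> inference_bases \<and>
        (conditions_to I1 I2 \<or> conditions_to I2 I1)}"

definition procedure :: "'a set \<Rightarrow> (('p, 'x) inference_base \<times> 'a) set \<Rightarrow> bool" where
  "procedure \<A> Ev \<longleftrightarrow> Ev \<subseteq> inference_bases \<times> \<A>"

definition preserves ::
  "(('p, 'x) inference_base \<times> 'a) set \<Rightarrow> ('p, 'x) inference_base rel \<Rightarrow> bool" where
  "preserves Ev D \<longleftrightarrow> (\<forall>(I1, I2)\<in>D. Ev `` {I1} = Ev `` {I2})"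

end

theory Submission
  imports Defs
begin

text \<open>
  This is Birnbaum's argument. Given two likelihood-equivalent bases \<open>(E1, x1)\<close> and \<open>(E2, x2)\<close>, toss
  a fair coin to decide which of the two experiments is performed, and record both the coin and the
  outcome. The coin is ancillary and takes both of its values with probability \<open>1/2\<close>, so
  conditioning on it leads from the mixture with outcome \<open>(i, xi)\<close> back to \<open>(Ei, xi)\<close>. It is
  surjective onto a two-element set, so the mixed-experiment branch of the conditionality relation
  applies, whatever the outcome codes are. Inside the mixture the two recorded outcomes still have
  proportional likelihood functions, both having been halved. The partition of a sample space into
  classes of proportional likelihood functions is minimal sufficient, hence does not separate the
  two outcomes, and the sufficiency relation links them. A procedure that preserves both relations
  is therefore constant along the chain
  \<open>(E1, x1)\<close>, \<open>(mixture, (1, x1))\<close>, \<open>(mixture, (2, x2))\<close>, \<open>(E2, x2)\<close>.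

  The recorded pairs have to be elements of the universe \<open>'x\<close>. This is where its infinity enters: any
  finite set of pairs can be encoded injectively in it. The sufficiency half of the argument is
  \<open>likelihood_imp_sufficiency_same_model\<close>; the conditionality half is \<open>conditions_to_mixture\<close>.
\<close>

section \<open>The likelihood partition is minimal sufficient\<close>

lemma likelihood_rel_refl: "I \<in> inference_bases \<Longrightarrow> (I, I) \<in> likelihood_rel"
  by (cases I) (auto simp: likelihood_rel_def intro!: exI[of _ 1])

lemma likelihood_rel_sym: "(I, J) \<in> likelihood_rel \<Longrightarrow> (J, I) \<in> likelihood_rel"
proof (cases I; cases J)
  fix E x F y
  assume "(I, J) \<in> likelihood_rel" and I: "I = (E, x)" and J: "J = (F, y)"
  then obtain k where "(E, x) \<in> inference_bases" "(F, y) \<in> inference_bases" "k > 0"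
    "\<And>\<theta>. pmf (law E \<theta>) x = k * pmf (law F \<theta>) y"
    by (auto simp: likelihood_rel_def)
  then show "(J, I) \<in> likelihood_rel"
    by (auto simp: I J likelihood_rel_def intro!: exI[of _ "inverse k"])
qed

lemma likelihood_rel_trans:
  "(I, J) \<in> likelihood_rel \<Longrightarrow> (J, K) \<in> likelihood_rel \<Longrightarrow> (I, K) \<in> likelihood_rel"
proof (cases I; cases J; cases K)
  fix E x F y G z
  assume "(I, J) \<in> likelihood_rel" "(J, K) \<in> likelihood_rel"
    and I: "I = (E, x)" and J: "J = (F, y)" and K: "K = (G, z)"
  then obtain k l where "(E, x) \<in> inference_bases" "(G, z) \<in> inference_bases" "k > 0" "l > 0"
    "\<And>\<theta>. pmf (law E \<theta>) x = k * pmf (law F \<theta>) y"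
    "\<And>\<theta>. pmf (law F \<theta>) y = l * pmf (law G \<theta>) z"
    by (auto simp: likelihood_rel_def)
  then show "(I, K) \<in> likelihood_rel"
    by (auto simp: I K likelihood_rel_def intro!: exI[of _ "k * l"])
qed

text \<open>
  Equivalent outcomes satisfy the same predicate under the choice operator, so they receive the same
  representative. Statistics have to take values in \<open>'x\<close>, which is why a representative is used
  instead of the class itself.
\<close>

definition likelihood_statistic :: "('p, 'x) stat_model \<Rightarrow> 'x \<Rightarrow> 'x" where
  "likelihood_statistic E x = (SOME y. ((E, x), (E, y)) \<in> likelihood_rel)"

lemma likelihood_statistic_eq_iff:
  assumes "is_model E" "x \<in> sample_space E" "y \<in> sample_space E"
  shows "likelihood_statistic E x = likelihood_statistic E y
           \<longleftrightarrow> ((E, x), (E, y)) \<in> likelihood_rel"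
proof
  have rep: "((E, z), (E, likelihood_statistic E z)) \<in> likelihood_rel"
    if "z \<in> sample_space E" for z
  proof -
    have "((E, z), (E, z)) \<in> likelihood_rel"
      by (rule likelihood_rel_refl) (simp add: inference_bases_def that assms(1))
    then show ?thesis
      unfolding likelihood_statistic_def by (rule someI)
  qed
  assume "likelihood_statistic E x = likelihood_statistic E y"
  then have "((E, x), (E, likelihood_statistic E y)) \<in> likelihood_rel"
    using rep[OF assms(2)] by (simp only:)
  then show "((E, x), (E, y)) \<in> likelihood_rel"
    using likelihood_rel_sym[OF rep[OF assms(3)]] by (rule likelihood_rel_trans)
next
  assume xy: "((E, x), (E, y)) \<in> likelihood_rel"
  have "((E, x), (E, z)) \<in> likelihood_rel \<longleftrightarrow> ((E, y), (E, z)) \<in> likelihood_rel" for z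
    using xy likelihood_rel_sym[OF xy] by (blast intro: likelihood_rel_trans)
  then show "likelihood_statistic E x = likelihood_statistic E y"
    by (simp only: likelihood_statistic_def)
qed

text \<open>
  The mass of the class of \<open>x\<close> is a sum of positive multiples of the likelihood function of \<open>x\<close>
  itself, with multipliers free of the parameter; their sum is the reciprocal of the conditional
  probability of \<open>x\<close> given its class.
\<close>

lemma sufficient_likelihood_statistic:
  assumes E: "is_model E"
  shows "sufficient E (likelihood_statistic E)"
proof -
  let ?T = "likelihood_statistic E"
  have "\<exists>g. \<forall>\<theta>. pmf (law E \<theta>) x = g * pmf (induced_law E ?T \<theta>) (?T x)"
    if x: "x \<in> sample_space E" for x
  proof -
    let ?B = "{y. y \<in> sample_space E \<and> ?T y = ?T x}"
    have "\<forall>y\<in>?B. \<exists>k. k > 0 \<and> (\<forall>\<theta>. pmf (law E \<theta>) y = k * pmf (law E \<theta>) x)"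
    proof
      fix y
      assume "y \<in> ?B"
      then have y: "y \<in> sample_space E" and "?T y = ?T x"
        by simp_all
      then have "((E, y), (E, x)) \<in> likelihood_rel"
        by (simp only: likelihood_statistic_eq_iff[OF E y x])
      then show "\<exists>k. k > 0 \<and> (\<forall>\<theta>. pmf (law E \<theta>) y = k * pmf (law E \<theta>) x)"
        unfolding likelihood_rel_def by blast
    qed
    from bchoice[OF this] obtain k where k: "\<And>y. y \<in> ?B \<Longrightarrow> k y > 0"
      "\<And>y \<theta>. y \<in> ?B \<Longrightarrow> pmf (law E \<theta>) y = k y * pmf (law E \<theta>) x"
      by blast
    have "finite ?B" using E by (auto simp: is_model_def)
    then have pos: "sum k ?B > 0"
      using x by (intro sum_pos k(1)) auto
    have "pmf (induced_law E ?T \<theta>) (?T x) = sum k ?B * pmf (law E \<theta>) x" for \<theta>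
      unfolding pmf_induced_law[OF E] sum_distrib_right by (intro sum.cong refl k(2))
    then show ?thesis
      using pos by (intro exI[of _ "inverse (sum k ?B)"]) simp
  qed
  then have "\<forall>x\<in>sample_space E. \<exists>g. \<forall>\<theta>.
      pmf (law E \<theta>) x = g * pmf (induced_law E ?T \<theta>) (?T x)"
    by (rule ballI)
  from bchoice[OF this] show ?thesis
    unfolding sufficient_def .
qed

text \<open>
  If \<open>U\<close> is sufficient, then the likelihood function of an outcome is a multiple of one that depends
  on the outcome through \<open>U\<close> only. Effectiveness of the outcomes makes the multiplier positive.
\<close>

lemma sufficient_imp_likelihood_rel:
  assumes E: "is_model E" and U: "sufficient E U"
    and x: "x \<in> sample_space E" and y: "y \<in> sample_space E" and eq: "U x = U y"
  shows "((E, x), (E, y)) \<in> likelihood_rel"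
proof -
  obtain g where g: "\<And>z \<theta>. z \<in> sample_space E \<Longrightarrow>
      pmf (law E \<theta>) z = g z * pmf (induced_law E U \<theta>) (U z)"
    using U by (auto simp: sufficient_def)
  have pos: "g z > 0" if z: "z \<in> sample_space E" for z
  proof -
    obtain \<theta> where "pmf (law E \<theta>) z > 0"
      using E z unfolding is_model_def by blast
    then have "g z * pmf (induced_law E U \<theta>) (U z) > 0"
      by (simp only: g[OF z])
    then show ?thesis
      by (simp add: zero_less_mult_iff)
  qed
  have "pmf (law E \<theta>) x = g x / g y * pmf (law E \<theta>) y" for \<theta>
    using pos[OF y] by (simp add: g[OF x] g[OF y] eq)
  moreover have "g x / g y > 0"
    using pos x y by simp
  ultimately have "\<exists>k>0. \<forall>\<theta>. pmf (law E \<theta>) x = k * pmf (law E \<theta>) y"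
    by blast
  then show ?thesis
    unfolding likelihood_rel_def inference_bases_def using E x y by blast
qed

lemma minimal_sufficient_likelihood_statistic:
  assumes E: "is_model E"
  shows "minimal_sufficient E (likelihood_statistic E)"
  unfolding minimal_sufficient_def
proof (intro conjI allI impI)
  show "sufficient E (likelihood_statistic E)"
    using E by (rule sufficient_likelihood_statistic)
  fix U :: "'b \<Rightarrow> 'b"
  assume U: "sufficient E U"
  have "likelihood_statistic E x = likelihood_statistic E (inv_into (sample_space E) U (U x))"
    if x: "x \<in> sample_space E" for x
  proof -
    have y: "inv_into (sample_space E) U (U x) \<in> sample_space E"
      and eq: "U x = U (inv_into (sample_space E) U (U x))"
      using x by (simp_all add: inv_into_into f_inv_into_f)
    show ?thesis
      using sufficient_imp_likelihood_rel[OF E U x y eq]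
      by (simp only: likelihood_statistic_eq_iff[OF E x y])
  qed
  then show "\<exists>\<phi>. \<forall>x\<in>sample_space E. likelihood_statistic E x = \<phi> (U x)"
    by (intro exI[of _ "\<lambda>u. likelihood_statistic E (inv_into (sample_space E) U u)"]) blast
qed

text \<open>
  Both minimal sufficient statistics in the sufficiency relation can be taken to be the likelihood
  partition, and the bijection between their ranges to be the identity.
\<close>

lemma likelihood_imp_sufficiency_same_model:
  assumes "((E, x), (E, y)) \<in> likelihood_rel"
  shows "((E, x), (E, y)) \<in> sufficiency_rel"
proof -
  have bases: "(E, x) \<in> inference_bases" "(E, y) \<in> inference_bases"
    using assms by (auto simp: likelihood_rel_def)
  then have E: "is_model E" "x \<in> sample_space E" "y \<in> sample_space E"
    by (auto simp: inference_bases_def)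
  have "likelihood_statistic E x = id (likelihood_statistic E y)"
    using likelihood_statistic_eq_iff[OF E] assms by simp
  then show ?thesis
    using bases minimal_sufficient_likelihood_statistic[OF E(1)]
    unfolding sufficiency_rel_def mem_Collect_eq prod.case
    by (intro conjI exI[of _ "likelihood_statistic E"] exI[of _ id]) simp_all
qed

section \<open>Fair mixtures of two experiments\<close>

text \<open>
  The two experiments are indexed by the outcome of the coin, and \<open>j\<close> encodes the recorded pairs
  as elements of the universe. The mixed-experiment branch puts no condition on outcome codes, so
  the mixture can carry an arbitrary injective one.
\<close>

definition mixture ::
  "(bool \<times> 'x \<Rightarrow> 'x) \<Rightarrow> (bool \<Rightarrow> ('p, 'x) stat_model) \<Rightarrow> ('p, 'x) stat_model" where
  "mixture j E = (let X = j ` (SIGMA b:UNIV. sample_space (E b)) in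
     \<lparr>sample_space = X,
      law = (\<lambda>\<theta>. bernoulli_pmf (1/2) \<bind> (\<lambda>b. map_pmf (\<lambda>x. j (b, x)) (law (E b) \<theta>))),
      code = restrict (SOME c. inj_on c X) X\<rparr>)"

lemma sample_space_mixture:
  "sample_space (mixture j E) = j ` (SIGMA b:UNIV. sample_space (E b))"
  by (simp add: mixture_def Let_def)

lemma law_mixture:
  "law (mixture j E) \<theta>
     = bernoulli_pmf (1/2) \<bind> (\<lambda>b. map_pmf (\<lambda>x. j (b, x)) (law (E b) \<theta>))"
  by (simp add: mixture_def Let_def)

context
  fixes j :: "bool \<times> 'x \<Rightarrow> 'x" and E :: "bool \<Rightarrow> ('p, 'x) stat_model"
  assumes models: "\<And>b. is_model (E b)"
    and inj: "inj_on j (SIGMA b:UNIV. sample_space (E b))"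
begin

lemma set_pmf_component: "x \<in> set_pmf (law (E b) \<theta>) \<Longrightarrow> x \<in> sample_space (E b)"
  using models[of b] unfolding is_model_def by blast

lemma encode_pair_eqD:
  "j (b, x) = j (c, y) \<Longrightarrow> x \<in> sample_space (E b) \<Longrightarrow> y \<in> sample_space (E c) \<Longrightarrow> b = c \<and> x = y"
  using inj_onD[OF inj, of "(b, x)" "(c, y)"] by simp

text \<open>
  Every outcome keeps half of its mass, because injectivity of \<open>j\<close> prevents the other experiment and
  the other outcomes of the same one from contributing to it.
\<close>

lemma pmf_mixture:
  assumes x: "x \<in> sample_space (E b)"
  shows "pmf (law (mixture j E) \<theta>) (j (b, x)) = pmf (law (E b) \<theta>) x / 2"
proof -
  have same: "pmf (map_pmf (\<lambda>x. j (b, x)) (law (E b) \<theta>)) (j (b, x)) = pmf (law (E b) \<theta>) x"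
  proof -
    have "pmf (map_pmf (\<lambda>x. j (b, x)) (law (E b) \<theta>)) (j (b, x))
        = measure_pmf.prob (law (E b) \<theta>) ((\<lambda>x. j (b, x)) -` {j (b, x)})"
      by (simp add: pmf_map)
    also have "\<dots> = measure_pmf.prob (law (E b) \<theta>) {x}"
    proof (rule measure_prob_cong_0)
      fix y
      assume "y \<in> (\<lambda>x. j (b, x)) -` {j (b, x)} - {x}"
      then have "y \<notin> sample_space (E b)"
        using encode_pair_eqD[of b y b x] x by auto
      then show "pmf (law (E b) \<theta>) y = 0"
        using set_pmf_component[of y b \<theta>] by (auto simp: set_pmf_iff)
    qed auto
    finally show ?thesis by (simp add: measure_pmf_single)
  qed
  have other: "pmf (map_pmf (\<lambda>x. j (\<not> b, x)) (law (E (\<not> b)) \<theta>)) (j (b, x)) = 0"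
  proof -
    have "j (b, x) \<noteq> j (\<not> b, y)" if "y \<in> set_pmf (law (E (\<not> b)) \<theta>)" for y
      using encode_pair_eqD[of b x "\<not> b" y] x set_pmf_component[OF that] by auto
    then show ?thesis
      by (auto simp: pmf_eq_0_set_pmf)
  qed
  show ?thesis
    using same other by (cases b) (simp_all add: law_mixture pmf_bind)
qed

lemma is_model_mixture: "is_model (mixture j E)"
  unfolding is_model_def
proof (intro conjI ballI allI)
  let ?M = "mixture j E"
  have "finite (sample_space (E b))" for b
    using models[of b] unfolding is_model_def by blast
  then show fin: "finite (sample_space ?M)"
    unfolding sample_space_mixture by (intro finite_imageI finite_SigmaI finite_class.finite_UNIV)
  obtain x where "x \<in> sample_space (E True)"
    using models[of True] unfolding is_model_def by blast
  then show "sample_space ?M \<noteq> {}"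
    unfolding sample_space_mixture by blast
  show "set_pmf (law ?M \<theta>) \<subseteq> sample_space ?M" for \<theta>
    unfolding sample_space_mixture law_mixture set_bind_pmf set_map_pmf
    using set_pmf_component by blast
  have code: "code ?M = restrict (SOME c. inj_on c (sample_space ?M)) (sample_space ?M)"
    by (simp add: mixture_def Let_def)
  show "code ?M \<in> extensional (sample_space ?M)"
    unfolding code by (rule restrict_extensional)
  have "\<exists>c :: 'x \<Rightarrow> nat. inj_on c (sample_space ?M)"
    using finite_imp_inj_to_nat_seg[OF fin] by blast
  then show "inj_on (code ?M) (sample_space ?M)"
    unfolding code inj_on_restrict_eq by (rule someI_ex)
  fix z
  assume "z \<in> sample_space ?M"
  then obtain b x where z: "z = j (b, x)" "x \<in> sample_space (E b)"
    unfolding sample_space_mixture by blast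
  obtain \<theta> where "pmf (law (E b) \<theta>) x > 0"
    using models[of b] z(2) unfolding is_model_def by blast
  then show "\<exists>\<theta>. pmf (law ?M \<theta>) z > 0"
    using pmf_mixture[OF z(2), of \<theta>] z(1) by (intro exI[of _ \<theta>]) simp
qed

text \<open>
  The ancillary statistic reads the coin off the recorded pair. The arbitrary injection \<open>lab\<close> only
  serves to have its two values in the universe.
\<close>

lemma conditions_to_mixture:
  fixes lab :: "bool \<Rightarrow> 'x"
  assumes lab: "inj lab" and x: "x \<in> sample_space (E b)"
  shows "conditions_to (mixture j E, j (b, x)) (E b, x)"
proof -
  let ?M = "mixture j E" and ?S = "SIGMA b:UNIV. sample_space (E b)"
  define A where "A z = lab (fst (inv_into ?S j z))" for z
  have A: "A (j (c, y)) = lab c" if "y \<in> sample_space (E c)" for c y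
    using inv_into_f_f[OF inj] that by (simp add: A_def)
  define B where "B = {z \<in> sample_space ?M. A z = A (j (b, x))}"
  have B: "(\<lambda>y. j (b, y)) ` sample_space (E b) = B"
  proof (intro equalityI subsetI)
    fix z
    assume "z \<in> (\<lambda>y. j (b, y)) ` sample_space (E b)"
    then show "z \<in> B"
      using A x by (auto simp: B_def sample_space_mixture)
  next
    fix z
    assume z: "z \<in> B"
    then obtain c y where cy: "z = j (c, y)" "y \<in> sample_space (E c)"
      by (auto simp: B_def sample_space_mixture)
    then have "lab c = lab b"
      using z A[OF cy(2)] A[OF x] by (simp add: B_def)
    then show "z \<in> (\<lambda>y. j (b, y)) ` sample_space (E b)"
      using cy injD[OF lab] by blast
  qed
  have law_A: "induced_law ?M A \<theta> = map_pmf lab (bernoulli_pmf (1/2))" for \<theta>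
  proof -
    have "map_pmf A (map_pmf (\<lambda>y. j (c, y)) (law (E c) \<theta>)) = return_pmf (lab c)" for c
    proof -
      have "map_pmf (\<lambda>y. A (j (c, y))) (law (E c) \<theta>) = map_pmf (\<lambda>y. lab c) (law (E c) \<theta>)"
        by (intro map_pmf_cong refl A set_pmf_component)
      then show ?thesis
        by (simp add: map_pmf_comp)
    qed
    then show ?thesis
      by (simp add: induced_law_def law_mixture map_bind_pmf map_pmf_def[of lab])
  qed
  have prob_B: "measure_pmf.prob (law ?M \<theta>) B = 1/2" for \<theta>
  proof -
    have "measure_pmf.prob (law ?M \<theta>) B = measure_pmf.prob (law ?M \<theta>) (A -` {lab b})"
    proof (rule measure_prob_cong_0)
      fix z
      assume "z \<in> A -` {lab b} - B"
      then have "z \<notin> sample_space ?M"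
        by (auto simp: B_def A[OF x])
      then show "pmf (law ?M \<theta>) z = 0"
        using is_model_mixture unfolding is_model_def by (blast intro: set_pmf_iff[THEN iffD2])
    qed (auto simp: B_def A[OF x])
    also have "\<dots> = pmf (map_pmf lab (bernoulli_pmf (1/2))) (lab b)"
      using law_A[of \<theta>] by (simp add: induced_law_def flip: pmf_map)
    also have "\<dots> = 1/2"
      by (cases b) (simp_all add: pmf_map_inj'[OF lab])
    finally show ?thesis .
  qed
  have "ancillary ?M A"
    by (simp add: ancillary_def law_A)
  moreover have "inj_on (\<lambda>y. j (b, y)) (sample_space (E b))"
    using inj by (auto simp: inj_on_def)
  moreover have "pmf (law (E b) \<theta>) y = pmf (law ?M \<theta>) (j (b, y)) / measure_pmf.prob (law ?M \<theta>) B"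
    if "y \<in> sample_space (E b)" for \<theta> y
    using pmf_mixture[OF that] by (simp add: prob_B)
  moreover have "\<exists>u\<in>A ` sample_space ?M. \<exists>v\<in>A ` sample_space ?M. u \<noteq> v"
  proof -
    have "lab c \<in> A ` sample_space ?M" for c
    proof -
      obtain y where "y \<in> sample_space (E c)"
        using models[of c] unfolding is_model_def by blast
      then show ?thesis
        using A[of y c] unfolding sample_space_mixture by (intro image_eqI[of _ _ "j (c, y)"]) auto
    qed
    then show ?thesis
      using injD[OF lab, of True False] by blast
  qed
  ultimately show ?thesis
    using B unfolding conditions_to_def Let_def prod.case
    by - (rule exI[of _ A], rule exI[of _ "A ` sample_space ?M"],
        rule exI[of _ "\<lambda>y. j (b, y)"], fold B_def, intro conjI disjI2, simp_all add: prob_B)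
qed

end

section \<open>Procedures that preserve sufficiency and conditionality\<close>

lemma finite_inj_on_into_infinite:
  assumes "infinite (UNIV :: 'x set)" and "finite S"
  shows "\<exists>f :: 'b \<Rightarrow> 'x. inj_on f S"
proof -
  obtain X :: "'x set" where "finite X" "card X = card S"
    using infinite_arbitrarily_large[OF assms(1)] by blast
  then show ?thesis
    using card_le_inj[OF assms(2), of X] by auto
qed

theorem corollary3p2:
  fixes \<A> :: "'a set"
    and Ev :: "(('p::finite, 'x) inference_base \<times> 'a) set"
  assumes "infinite (UNIV :: 'x set)"
    and "procedure \<A> Ev"
    and "preserves Ev sufficiency_rel"
    and "preserves Ev conditionality_rel"
  shows "\<forall>(I1, I2) \<in> likelihood_rel - (sufficiency_rel \<union> conditionality_rel).
           Ev `` {I1} = Ev `` {I2}"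
proof (intro ballI)
  fix P :: "('p, 'x) inference_base \<times> ('p, 'x) inference_base"
  assume "P \<in> likelihood_rel - (sufficiency_rel \<union> conditionality_rel)"
  moreover obtain E1 x1 E2 x2 where P: "P = ((E1, x1), (E2, x2))"
    by (metis prod.exhaust)
  ultimately have L: "((E1, x1), (E2, x2)) \<in> likelihood_rel"
    by blast
  define E where "E b = (if b then E1 else E2)" for b
  define x where "x b = (if b then x1 else x2)" for b
  have models: "is_model (E b)" and x: "x b \<in> sample_space (E b)" for b
    using L by (simp_all add: E_def x_def likelihood_rel_def inference_bases_def)
  have "finite (sample_space (E b))" for b
    using models[of b] unfolding is_model_def by blast
  then have "finite (SIGMA b:UNIV. sample_space (E b))"
    by (intro finite_SigmaI finite_class.finite_UNIV)
  then obtain j :: "bool \<times> 'x \<Rightarrow> 'x" where j: "inj_on j (SIGMA b:UNIV. sample_space (E b))"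
    using finite_inj_on_into_infinite[OF assms(1)] by blast
  obtain lab :: "bool \<Rightarrow> 'x" where lab: "inj lab"
    using finite_inj_on_into_infinite[OF assms(1) finite_class.finite_UNIV] by blast
  let ?M = "mixture j E"
  have M: "is_model ?M"
    using models j by (rule is_model_mixture)
  have base: "(?M, j (b, x b)) \<in> inference_bases" for b
    using M x by (auto simp: inference_bases_def sample_space_mixture)
  have cond: "Ev `` {(?M, j (b, x b))} = Ev `` {(E b, x b)}" for b
  proof -
    have "((?M, j (b, x b)), (E b, x b)) \<in> conditionality_rel"
      using base conditions_to_mixture[OF models j lab x] models x
      by (auto simp: conditionality_rel_def inference_bases_def)
    then show ?thesis
      using assms(4) by (auto simp: preserves_def)
  qed
  \<comment> \<open>Both likelihood functions are halved in the mixture, so their ratio \<open>k\<close> is unchanged.\<close>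
  have "((?M, j (True, x True)), (?M, j (False, x False))) \<in> likelihood_rel"
  proof -
    obtain k where "k > 0" "\<And>\<theta>. pmf (law (E True) \<theta>) (x True) = k * pmf (law (E False) \<theta>) (x False)"
      using L by (auto simp: likelihood_rel_def E_def x_def)
    then show ?thesis
      using base by (auto simp: likelihood_rel_def pmf_mixture[OF models j x] intro!: exI[of _ k])
  qed
  then have "((?M, j (True, x True)), (?M, j (False, x False))) \<in> sufficiency_rel"
    by (rule likelihood_imp_sufficiency_same_model)
  then have "Ev `` {(?M, j (True, x True))} = Ev `` {(?M, j (False, x False))}"
    using assms(3) by (auto simp: preserves_def)
  then have "Ev `` {(E1, x1)} = Ev `` {(E2, x2)}"
    using cond[of True] cond[of False] by (simp add: E_def x_def)
  then show "case P of (I1, I2) \<Rightarrow> Ev `` {I1} = Ev `` {I2}"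
    by (simp add: P)
qed

end
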